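(* Let $N$ be a 3-prime left near-ring and let $d : N \to N$ be a multiplicative derivation of $N$ such that $d(xy) = d(x)d(y)$ for all $x,y \in N$. Then $d = 0$.
   Context: A (left) near-ring is a set $N$ with two binary operations $+$ and $\cdot$ such that $(N,+)$ is a group (not assumed abelian, written additively with identity $0$), multiplication is associative, and $x(y+z) = xy + xz$ for all $x,y,z \in N$ (right distributivity and a multiplicative identity are not assumed). $N$ is 3-prime if, for $x,y \in N$, $xNy = \{0\}$ (i.e. $xny = 0$ for all $n \in N$) implies $x = 0$ or $y = 0$. A multiplicative derivation of $N$ is a map $d : N \to N$, not assumed additive, with $d(xy) = x d(y) + d(x) y$ for all $x,y \in N$. *)

theory Defs
  imports Main
begin

text \<open>
  Addition is not assumed commutative, so \<^class>\<open>group_add\<close> is the additive part. There is no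
  multiplicative identity and no right distributivity; in particular the products
  \<open>0 * x\<close> need not vanish.
\<close>

class left_near_ring = group_add + semigroup_mult +
  assumes left_distrib: "x * (y + z) = x * y + x * z"

class three_prime_near_ring = left_near_ring +
  assumes three_prime: "(\<forall>n. x * n * y = 0) \<Longrightarrow> x = 0 \<or> y = 0"

definition multiplicative_derivation :: "('a::left_near_ring \<Rightarrow> 'a) \<Rightarrow> bool" where
  "multiplicative_derivation d \<longleftrightarrow> (\<forall>x y. d (x * y) = x * d y + d x * y)"

end

theory Submission
  imports Defs
begin

text \<open>
  Evaluating \<open>d (x y z)\<close> as \<open>d ((x y) z)\<close> and as \<open>d x \<cdot> d (y z)\<close> gives \<open>x y d z = d x y d z\<close>.
  Replacing \<open>y\<close> by \<open>d y\<close>, this says \<open>x d (y z) = d x d (y z) = d (x (y z))\<close>, so the other summand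
  \<open>d x y z\<close> of the derivation rule for \<open>d (x (y z))\<close> vanishes, and 3-primeness applies with \<open>z = d x\<close>.
\<close>

theorem theorem2:
  fixes d :: "'a::three_prime_near_ring \<Rightarrow> 'a"
  assumes "multiplicative_derivation d"
    and "\<forall>x y. d (x * y) = d x * d y"
  shows "d = (\<lambda>x. 0)"
proof -
  have der: "d (x * y) = x * d y + d x * y" for x y
    using assms(1) by (simp add: multiplicative_derivation_def)
  have hom: "d (x * y) = d x * d y" for x y
    using assms(2) by blast
  have swap: "x * y * d z = d x * y * d z" for x y z
  proof -
    have "x * y * d z + d x * d y * z = d (x * y * z)"
      by (simp only: der[of "x * y" z] hom[of x y])
    \<comment> \<open>Grouping as \<open>x * (y * z)\<close> puts the sum \<open>d (y * z)\<close>
      in the right factor, where \<open>left_distrib\<close> can expand it.\<close>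
    also have "\<dots> = d x * d (y * z)"
      by (simp only: mult.assoc hom[of x "y * z"])
    also have "\<dots> = d x * y * d z + d x * d y * z"
      by (simp only: der[of y z] left_distrib mult.assoc)
    \<comment> \<open>Both sides end in the summand \<open>d x * d y * z\<close>, which cancels on
      the right in the additive group.\<close>
    finally show ?thesis by simp
  qed
  have "d x * y * z = 0" for x y z
  proof -
    have "x * d (y * z) + d x * (y * z) = d x * d (y * z)"
      using der[of x "y * z"] hom[of x "y * z"] by simp
    also have "\<dots> = x * d (y * z)"
      using swap[of x "d y" z] by (simp only: hom[of y z] mult.assoc)
    \<comment> \<open>The chain reads \<open>a + b = a\<close> with
      \<open>a = x * d (y * z)\<close>; cancelling \<open>a\<close> on the left gives
      \<open>b = 0\<close>.\<close>
    finally have "d x * (y * z) = 0"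
      using add_left_cancel[of "x * d (y * z)" "d x * (y * z)" 0] by simp
    then show ?thesis by (simp add: mult.assoc)
  qed
  then have "d x = 0" for x
    using three_prime[of "d x" "d x"] by blast
  then show ?thesis by blast
qed

end
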